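(* Consider the simplified three-person game of baccara banque with parameter $\theta$ (see context). For every $\theta\in\left(\frac{799}{1604},\frac12\right]$, Nash equilibria with $p_1=p_2=\frac9{11}$ are obtained by letting Banker draw or stand as prescribed by Table N (see context), with drawing probabilities $(r_1,r_2,r_3)$ on the three information sets $(10,10,6)$, $(10,11,6)$, $(11,10,6)$, at which he is indifferent. The set of $(r_1,r_2,r_3)$ arising in such equilibria is the line segment with extreme points $$\left(0,\frac{6715965}{10469888},\frac{6715965}{10469888}\right)\quad\text{and}\quad\left(\frac{2238655}{3807232},0,0\right).$$ When $\theta=1/2$ and all three participants play according to these equilibrium strategies, Banker's expected gain per unit stake is $$\frac{11138203216}{11^2\cdot 13^9}\approx0.00868040 .$$
   Context: Simplified game of baccara banque. Let $X_1,X_2,Y$ be i.i.d. on $\{0,\ldots,9\}$ with $P(\cdot=i)=q(i)=(16+9\delta_{i,0})/13^2$ (two-card totals of Player 1, Player 2, Banker), and let $X_1',X_2',Y'$ be i.i.d. on $\{0,\ldots,9\}$, independent of these, with $P(\cdot=k)=q'(k)=(1+3\delta_{k,0})/13$ (third-card values). $M(i)$ is the remainder of $i$ modulo $10$. Player $i$'s pure strategies are $u_i\in\{0,1\}$ ($0$ = stand on two-card total 5, $1$ = draw on 5); Player $i$ draws iff $X_i\le 4+u_i$. Put $K_i=X_i'$ if $X_i\le 4+u_i$, $K_i=10$ if $5+u_i\le X_i\le 7$ (stand), $K_i=11$ if $X_i\in\{8,9\}$ (natural); put $F_i=M(X_i+X_i')$ if $X_i\le 4+u_i$ and $F_i=X_i$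 otherwise. Banker's information sets are the 1144 triples $(k_1,k_2,j)\in I:=[\{0,\ldots,11\}^2\setminus\{(11,11)\}]\times\{0,\ldots,7\}$; a Banker pure strategy is a subset $T\subset I$, the set on which he draws. If $Y\ge 8$ or both $X_1,X_2\ge 8$, set $G_i=\mathrm{sgn}(X_i-Y)$. Otherwise let $B=M(Y+Y')$ if $(K_1,K_2,Y)\in T$ and $B=Y$ if not, and set $G_i=1$ if $X_i\ge 8$ and $G_i=\mathrm{sgn}(F_i-B)$ if $X_i\le 7$. The payoffs are $\theta E[G_1]$ to Player 1, $(1-\theta)E[G_2]$ to Player 2, and $-E[\theta G_1+(1-\theta)G_2]$ to Banker (in units of total amount bet). A behavioral strategy of Banker is a map $\beta:I\to[0,1]$, $\beta(k_1,k_2,j)$ being the probability of drawing at $(k_1,k_2,j)$; since at most one information set is met per play, every mixed strategy over subsets $T$ is payoff-equivalent to the behavioral strategy of its marginal drawing probabilities. Player $i$'s mixed strategy is the probability $p_i\in[0,1]$ of drawing on 5, and the three participants randomize independently. A Nash equilibrium is a triple $(p_1,p_2,\beta)$ such that no one of the three participants can increase his own expected payoff by a unilateral change of strategy. Table N (Banker's maximum drawing total as a function of $k_1$ (row) and $k_2$ (column), columns $k_2=0,1,\ldots,11$). An entry $m$ means: draw on $j\le m$, stand on $j>m$. An entry $5{+}$ means: draw on $j\le 5$, possibly mix on $j=6$, stand on $j=7$. $k_1=0$: 3,3,3,4,4,4,4,3,3,3,5,3; $k_1=1$: 3,3,4,4,4,4,4,4,3,3,5,3; $k_1=2$: 3,4,4,4,4,4,5,4,3,3,5,4;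 $k_1=3$: 4,4,4,4,4,5,5,4,4,3,5,4; $k_1=4$: 4,4,4,4,5,5,5,5,4,4,5,5; $k_1=5$: 4,4,4,5,5,5,5,5,5,4,5,5; $k_1=6$: 4,4,5,5,5,5,6,6,5,4,6,6; $k_1=7$: 3,4,4,4,5,5,6,6,3,3,6,6; $k_1=8$: 3,3,3,4,4,5,5,3,2,3,5,2; $k_1=9$: 3,3,3,3,4,4,4,3,3,3,5,3; $k_1=10$: 5,5,5,5,5,5,6,6,5,5,5+,5+; $k_1=11$: 3,3,4,4,5,5,6,6,2,3,5+,(none). *)

theory Defs
  imports "HOL-Probability.Probability"
begin

definition two_card_pmf :: "nat pmf" where
  "two_card_pmf = embed_pmf (\<lambda>i. if i \<le> 9 then (16 + 9 * of_bool (i = 0)) / 13\<^sup>2 else 0)"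

definition third_card_pmf :: "nat pmf" where
  "third_card_pmf = embed_pmf (\<lambda>k. if k \<le> 9 then (1 + 3 * of_bool (k = 0)) / 13 else 0)"

lemma pmf_embed_digit:
  fixes w :: "nat \<Rightarrow> real"
  assumes nonneg: "\<And>i. w i \<ge> 0" and total: "(\<Sum>i\<le>9. w i) = 1"
  shows "pmf (embed_pmf (\<lambda>i. if i \<le> 9 then w i else 0)) j = (if j \<le> 9 then w j else 0)"
proof (rule pmf_embed_pmf)
  have "(\<integral>\<^sup>+ i. ennreal (if i \<le> 9 then w i else 0) \<partial>count_space UNIV)
      = (\<Sum>i\<le>9. ennreal (if i \<le> 9 then w i else 0))"
    by (rule nn_integral_count_space'[OF finite_atMost]) auto
  also have "\<dots> = (\<Sum>i\<le>9. ennreal (w i))"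
    by (rule sum.cong) auto
  also have "\<dots> = 1"
    using nonneg total by (simp add: sum_ennreal)
  finally show "(\<integral>\<^sup>+ i. ennreal (if i \<le> 9 then w i else 0) \<partial>count_space UNIV) = 1" .
qed (use nonneg in auto)

lemma pmf_two_card:
  "pmf two_card_pmf i = (if i \<le> 9 then (16 + 9 * of_bool (i = 0)) / 13\<^sup>2 else 0)"
  unfolding two_card_pmf_def
  by (rule pmf_embed_digit) (simp_all add: eval_nat_numeral)

lemma pmf_third_card:
  "pmf third_card_pmf k = (if k \<le> 9 then (1 + 3 * of_bool (k = 0)) / 13 else 0)"
  unfolding third_card_pmf_def
  by (rule pmf_embed_digit) (simp_all add: eval_nat_numeral)

text \<open>In the following, \<open>u\<close> says whether the player draws on a two-card total of 5, \<open>x\<close> is his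
  two-card total, and \<open>x'\<close> is the value of his third card (used only if he draws).\<close>

definition player_draws :: "bool \<Rightarrow> nat \<Rightarrow> bool" where
  "player_draws u x \<longleftrightarrow> x \<le> 4 + of_bool u"

text \<open>What Banker sees of a player: the third card, or 10 for a stand, or 11 for a natural.\<close>

definition observed :: "bool \<Rightarrow> nat \<Rightarrow> nat \<Rightarrow> nat" where
  "observed u x x' = (if player_draws u x then x' else if x \<le> 7 then 10 else 11)"

definition final_total :: "bool \<Rightarrow> nat \<Rightarrow> nat \<Rightarrow> nat" where
  "final_total u x x' = (if player_draws u x then (x + x') mod 10 else x)"

definition banker_total :: "bool \<Rightarrow> nat \<Rightarrow> nat \<Rightarrow> nat" where
  "banker_total d y y' = (if d then (y + y') mod 10 else y)"

text \<open>The outcome \<open>G\<^sub>i\<close> for a player, where \<open>xo\<close> is the other player's two-card total, \<open>y\<close> is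
  Banker's two-card total and \<open>b\<close> is Banker's final total.\<close>

definition outcome :: "bool \<Rightarrow> nat \<Rightarrow> nat \<Rightarrow> nat \<Rightarrow> nat \<Rightarrow> nat \<Rightarrow> real" where
  "outcome u x x' xo y b =
     (if y \<ge> 8 \<or> (x \<ge> 8 \<and> xo \<ge> 8) then sgn (real x - real y)
      else if x \<ge> 8 then 1
      else sgn (real (final_total u x x') - real b))"

definition info_sets :: "(nat \<times> nat \<times> nat) set" where
  "info_sets = {(k1, k2, j). k1 \<le> 11 \<and> k2 \<le> 11 \<and> (k1, k2) \<noteq> (11, 11) \<and> j \<le> 7}"

text \<open>A strategy of Banker assigns a drawing probability to every element of \<open>info_sets\<close>; its
  values elsewhere are irrelevant, because \<open>(observed u1 x1 x1', observed u2 x2 x2', y)\<close> lies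
  outside \<open>info_sets\<close> precisely when \<open>outcome\<close> ignores Banker's final total for both players
  (\<open>y \<ge> 8\<close>, or two naturals).\<close>

type_synonym banker_strategy = "nat \<times> nat \<times> nat \<Rightarrow> real"

definition behavioral :: "banker_strategy \<Rightarrow> bool" where
  "behavioral \<beta> \<longleftrightarrow> (\<forall>s\<in>info_sets. \<beta> s \<in> {0..1})"

text \<open>The joint distribution of \<open>(G\<^sub>1, G\<^sub>2)\<close>.\<close>

definition play :: "real \<Rightarrow> real \<Rightarrow> banker_strategy \<Rightarrow> (real \<times> real) pmf" where
  "play p1 p2 \<beta> = do {
     u1 \<leftarrow> bernoulli_pmf p1;
     u2 \<leftarrow> bernoulli_pmf p2;
     x1 \<leftarrow> two_card_pmf;
     x2 \<leftarrow> two_card_pmf;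
     y \<leftarrow> two_card_pmf;
     x1' \<leftarrow> third_card_pmf;
     x2' \<leftarrow> third_card_pmf;
     y' \<leftarrow> third_card_pmf;
     d \<leftarrow> bernoulli_pmf (\<beta> (observed u1 x1 x1', observed u2 x2 x2', y));
     let b = banker_total d y y';
     return_pmf (outcome u1 x1 x1' x2 y b, outcome u2 x2 x2' x1 y b)
   }"

definition payoff1 :: "real \<Rightarrow> real \<Rightarrow> real \<Rightarrow> banker_strategy \<Rightarrow> real" where
  "payoff1 \<theta> p1 p2 \<beta> = \<theta> * measure_pmf.expectation (play p1 p2 \<beta>) (\<lambda>(g1, g2). g1)"

definition payoff2 :: "real \<Rightarrow> real \<Rightarrow> real \<Rightarrow> banker_strategy \<Rightarrow> real" where
  "payoff2 \<theta> p1 p2 \<beta> = (1 - \<theta>) * measure_pmf.expectation (play p1 p2 \<beta>) (\<lambda>(g1, g2). g2)"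

definition banker_payoff :: "real \<Rightarrow> real \<Rightarrow> real \<Rightarrow> banker_strategy \<Rightarrow> real" where
  "banker_payoff \<theta> p1 p2 \<beta> =
     - measure_pmf.expectation (play p1 p2 \<beta>) (\<lambda>(g1, g2). \<theta> * g1 + (1 - \<theta>) * g2)"

definition nash_equilibrium :: "real \<Rightarrow> real \<Rightarrow> real \<Rightarrow> banker_strategy \<Rightarrow> bool" where
  "nash_equilibrium \<theta> p1 p2 \<beta> \<longleftrightarrow>
     p1 \<in> {0..1} \<and> p2 \<in> {0..1} \<and> behavioral \<beta> \<and>
     (\<forall>p\<in>{0..1}. payoff1 \<theta> p p2 \<beta> \<le> payoff1 \<theta> p1 p2 \<beta>) \<and>
     (\<forall>p\<in>{0..1}. payoff2 \<theta> p1 p \<beta> \<le> payoff2 \<theta> p1 p2 \<beta>) \<and>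
     (\<forall>\<beta>'. behavioral \<beta>' \<longrightarrow> banker_payoff \<theta> p1 p2 \<beta>' \<le> banker_payoff \<theta> p1 p2 \<beta>)"

text \<open>Banker's maximum drawing total for \<open>k1\<close> (row) and \<open>k2\<close> (column). The entries at (10,10),
  (10,11) and (11,10), printed \<open>5+\<close> in the source, are 5 here; mixing on a total of 6 there is
  added in \<open>table_strategy\<close>. The entry at (11,11) is a placeholder, no decision arises there.\<close>

definition table_N :: "nat list list" where
  "table_N =
    [[3,3,3,4,4,4,4,3,3,3,5,3],
     [3,3,4,4,4,4,4,4,3,3,5,3],
     [3,4,4,4,4,4,5,4,3,3,5,4],
     [4,4,4,4,4,5,5,4,4,3,5,4],
     [4,4,4,4,5,5,5,5,4,4,5,5],
     [4,4,4,5,5,5,5,5,5,4,5,5],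
     [4,4,5,5,5,5,6,6,5,4,6,6],
     [3,4,4,4,5,5,6,6,3,3,6,6],
     [3,3,3,4,4,5,5,3,2,3,5,2],
     [3,3,3,3,4,4,4,3,3,3,5,3],
     [5,5,5,5,5,5,6,6,5,5,5,5],
     [3,3,4,4,5,5,6,6,2,3,5,0]]"

definition table_strategy :: "real \<Rightarrow> real \<Rightarrow> real \<Rightarrow> banker_strategy" where
  "table_strategy r1 r2 r3 =
     (\<lambda>(k1, k2, j).
        if (k1, k2, j) = (10, 10, 6) then r1
        else if (k1, k2, j) = (10, 11, 6) then r2
        else if (k1, k2, j) = (11, 10, 6) then r3
        else if j \<le> table_N ! k1 ! k2 then 1 else 0)"

end

theory Submission
  imports Defs
begin

text \<open>
  Given what Banker observes of them, the two hands are independent. So everything can be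
  computed from one-hand quantities: the probability \<open>seen p k\<close> that Banker observes \<open>k\<close>, and the
  player's expected \<open>score p k b\<close> on that event against a final total \<open>b\<close>; both are elementary
  (\<open>sum_over_view\<close>). The expected outcomes are bilinear in these (\<open>expectation_first\<close>).

  Banker's payoff is affine in every single drawing probability (\<open>banker_payoff_diff\<close>), the
  coefficient at \<open>(k1, k2, j)\<close> being, up to a positive factor, minus
  \<open>\<theta> * seen p k2 * swing k1 j + (1 - \<theta>) * seen p k1 * swing k2 j\<close>, where the swing is the effect of
  Banker's drawing on a player's score. A behavioral strategy is therefore a best response
  as soon as it draws only where this coefficient is nonnegative, and stands only where it is
  nonpositive. The coefficients are affine in \<open>\<theta>\<close>, so that their signs on the whole range of \<open>\<theta>\<close>
  follow from those at the two endpoints, which are checked by exact integer arithmetic against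
  the table (\<open>entries_optimal\<close>). At \<open>p = 9/11\<close> the swing for a standing player and Banker's total
  6 is zero, as is every swing for a natural; this is why Banker is indifferent at the three
  exceptional information sets, for every \<open>\<theta>\<close> (\<open>draw_cost_zero\<close>).

  Each player's payoff is affine in his probability of drawing on 5. Since \<open>9/11\<close> is an interior
  point, his strategy is a best response iff the slope vanishes (\<open>player_optimal_iff\<close>). For the
  table strategies this slope is a multiple of \<open>6715965 - 11421696 r1 - 10469888 r2\<close> for Player 1
  (\<open>vs_banker_slope_table\<close>) and, by symmetry, the same with \<open>r3\<close> in place of \<open>r2\<close> for
  Player 2. The two equations cut a segment out of the unit cube
  (\<open>nash_table_strategy_iff\<close>, \<open>indifference_line_eq_segment\<close>).
\<close>

section \<open>Hands and what Banker sees of them\<close>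

text \<open>A player's hand is recorded as the triple of the coin that decides about drawing on 5, the
  two-card total, and the third-card value, drawn in advance whether or not it is used.\<close>
definition hands :: "(bool \<times> nat \<times> nat) set" where
  "hands = UNIV \<times> {..9} \<times> {..9}"

definition hand_weight :: "real \<Rightarrow> bool \<times> nat \<times> nat \<Rightarrow> real" where
  "hand_weight p = (\<lambda>(u, x, x').
     pmf (bernoulli_pmf p) u * pmf two_card_pmf x * pmf third_card_pmf x')"

definition view :: "bool \<times> nat \<times> nat \<Rightarrow> nat" where
  "view = (\<lambda>(u, x, x'). observed u x x')"

text \<open>The order of arguments makes \<open>showdown b\<close> a function of a two-card and a final total. A natural
  counts as a win: whenever Banker's final total \<open>b\<close> is compared at all, he himself has no
  natural. The values are integers so that they serve the exact integer computations as well.\<close>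
definition showdown :: "nat \<Rightarrow> nat \<Rightarrow> nat \<Rightarrow> int" where
  "showdown b x f = (if x \<ge> 8 then 1 else sgn (int f - int b))"

definition hand_score :: "nat \<Rightarrow> bool \<times> nat \<times> nat \<Rightarrow> real" where
  "hand_score b = (\<lambda>(u, x, x'). of_int (showdown b x (final_total u x x')))"

definition seen :: "real \<Rightarrow> nat \<Rightarrow> real" where
  "seen p k = (\<Sum>h\<in>{h \<in> hands. view h = k}. hand_weight p h)"

text \<open>The scores are not normalised: they are expectations over the event that Banker observes \<open>k\<close>,
  so that the scores for the different observations add up.\<close>
definition score :: "real \<Rightarrow> nat \<Rightarrow> nat \<Rightarrow> real" where
  "score p k b = (\<Sum>h\<in>{h \<in> hands. view h = k}. hand_weight p h * hand_score b h)"

definition draw_effect :: "(nat \<Rightarrow> real) \<Rightarrow> nat \<Rightarrow> real" where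
  "draw_effect f j = (\<Sum>y'\<le>9. pmf third_card_pmf y' * f ((j + y') mod 10)) - f j"

section \<open>Expected outcomes\<close>

lemma finite_set_two_card: "finite (set_pmf two_card_pmf)" and set_two_card_subset: "set_pmf two_card_pmf \<subseteq> {..9}"
proof -
  show "set_pmf two_card_pmf \<subseteq> {..9}"
    by (auto simp: set_pmf_iff pmf_two_card split: if_splits)
  then show "finite (set_pmf two_card_pmf)"
    using finite_subset by blast
qed

lemma finite_set_third_card: "finite (set_pmf third_card_pmf)" and set_third_card_subset: "set_pmf third_card_pmf \<subseteq> {..9}"
proof -
  show "set_pmf third_card_pmf \<subseteq> {..9}"
    by (auto simp: set_pmf_iff pmf_third_card split: if_splits)
  then show "finite (set_pmf third_card_pmf)"
    using finite_subset by blast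
qed

lemma sum_pmf_third_card: "(\<Sum>x\<le>9. pmf third_card_pmf x) = 1"
  by (intro sum_pmf_eq_1 set_third_card_subset) auto

lemma sum_pmf_two_card: "(\<Sum>x\<le>9. pmf two_card_pmf x) = 1"
  by (intro sum_pmf_eq_1 set_two_card_subset) auto

lemma sum_pmf_bernoulli: "(\<Sum>x\<in>UNIV. pmf (bernoulli_pmf p) x) = 1"
  by (intro sum_pmf_eq_1) auto

lemma expectation_bind_two:
  fixes h :: "'b \<Rightarrow> real"
  assumes "\<And>x. finite (set_pmf (f x))"
  shows "measure_pmf.expectation (two_card_pmf \<bind> f) h =
    (\<Sum>x\<le>9. pmf two_card_pmf x * measure_pmf.expectation (f x) h)"
  by (subst pmf_expectation_bind[OF finite_atMost _ set_two_card_subset]) (auto simp: assms)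

lemma expectation_bind_third:
  fixes h :: "'b \<Rightarrow> real"
  assumes "\<And>x. finite (set_pmf (f x))"
  shows "measure_pmf.expectation (third_card_pmf \<bind> f) h =
    (\<Sum>x\<le>9. pmf third_card_pmf x * measure_pmf.expectation (f x) h)"
  by (subst pmf_expectation_bind[OF finite_atMost _ set_third_card_subset]) (auto simp: assms)

lemma expectation_bind_bern:
  fixes h :: "'b \<Rightarrow> real"
  assumes "\<And>x. finite (set_pmf (f x))"
  shows "measure_pmf.expectation (bernoulli_pmf p \<bind> f) h =
    (\<Sum>x\<in>UNIV. pmf (bernoulli_pmf p) x * measure_pmf.expectation (f x) h)"
  by (subst pmf_expectation_bind[of UNIV]) (auto simp: assms)

text \<open>The order in which the game draws its random values is immaterial; they are regrouped here
  into the two players' hands, which are independent, and Banker's cards.\<close>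
lemma expectation_play:
  "measure_pmf.expectation (play p1 p2 \<beta>) (\<lambda>(g1, g2). h g1 g2) =
    (\<Sum>(u1, x1, x1')\<in>hands. \<Sum>(u2, x2, x2')\<in>hands. \<Sum>y\<le>9.
      hand_weight p1 (u1, x1, x1') * hand_weight p2 (u2, x2, x2') * pmf two_card_pmf y *
      (\<Sum>y'\<le>9. pmf third_card_pmf y' *
        (\<Sum>d\<in>UNIV. pmf (bernoulli_pmf (\<beta> (observed u1 x1 x1', observed u2 x2 x2', y))) d *
          h (outcome u1 x1 x1' x2 y (banker_total d y y'))
            (outcome u2 x2 x2' x1 y (banker_total d y y')) :: real)))"
  (is "?E = (\<Sum>(u1, x1, x1')\<in>hands. \<Sum>(u2, x2, x2')\<in>hands. \<Sum>y\<le>9.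
      hand_weight p1 (u1, x1, x1') * hand_weight p2 (u2, x2, x2') * pmf two_card_pmf y *
       ?I u1 x1 x1' u2 x2 x2' y)")
proof -
  have "?E = (\<Sum>u1\<in>UNIV. \<Sum>u2\<in>UNIV. \<Sum>x1\<le>9. \<Sum>x2\<le>9. \<Sum>y\<le>9. \<Sum>x1'\<le>9. \<Sum>x2'\<le>9.
     pmf (bernoulli_pmf p1) u1 * (pmf (bernoulli_pmf p2) u2 * (pmf two_card_pmf x1 *
     (pmf two_card_pmf x2 * (pmf two_card_pmf y * (pmf third_card_pmf x1' * (pmf third_card_pmf x2' *
       ?I u1 x1 x1' u2 x2 x2' y)))))))"
    by (simp add: play_def Let_def expectation_bind_two expectation_bind_third expectation_bind_bern
        finite_set_two_card finite_set_third_card sum_distrib_left)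
  also have "\<dots> = (\<Sum>(u1, u2, x1, x2, y, x1', x2')\<in>UNIV \<times> UNIV \<times> {..9} \<times> {..9} \<times> {..9} \<times> {..9} \<times> {..9}.
     hand_weight p1 (u1, x1, x1') * hand_weight p2 (u2, x2, x2') * pmf two_card_pmf y *
       ?I u1 x1 x1' u2 x2 x2' y)"
    by (simp add: sum.cartesian_product[symmetric] hand_weight_def mult_ac)
  also have "\<dots> = (\<Sum>((u1, x1, x1'), (u2, x2, x2'), y)\<in>hands \<times> hands \<times> {..9}.
     hand_weight p1 (u1, x1, x1') * hand_weight p2 (u2, x2, x2') * pmf two_card_pmf y *
       ?I u1 x1 x1' u2 x2 x2' y)"
    by (rule sum.reindex_bij_witness[of _
        "\<lambda>((u1, x1, x1'), (u2, x2, x2'), y). (u1, u2, x1, x2, y, x1', x2')"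
        "\<lambda>(u1, u2, x1, x2, y, x1', x2'). ((u1, x1, x1'), (u2, x2, x2'), y)"])
      (auto simp: hands_def)
  also have "\<dots> = (\<Sum>(u1, x1, x1')\<in>hands. \<Sum>(u2, x2, x2')\<in>hands. \<Sum>y\<le>9.
     hand_weight p1 (u1, x1, x1') * hand_weight p2 (u2, x2, x2') * pmf two_card_pmf y *
       ?I u1 x1 x1' u2 x2 x2' y)"
    by (simp add: sum.cartesian_product' case_prod_unfold)
  finally show ?thesis .
qed


definition mirrored :: "banker_strategy \<Rightarrow> banker_strategy" where
  "mirrored \<beta> = (\<lambda>(k1, k2, j). \<beta> (k2, k1, j))"

text \<open>The game is symmetric in the two players, so expected outcomes need only be computed for
  the first.\<close>
lemma expectation_second:
  "measure_pmf.expectation (play p1 p2 \<beta>) snd = measure_pmf.expectation (play p2 p1 (mirrored \<beta>)) fst"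
  using expectation_play[of p1 p2 \<beta> "\<lambda>g1 g2. g2"] expectation_play[of p2 p1 "mirrored \<beta>" "\<lambda>g1 g2. g1"]
  unfolding case_prod_unfold
  by (subst (asm) (1) sum.swap) (simp add: mirrored_def mult_ac)

lemma view_le: "h \<in> hands \<Longrightarrow> view h \<le> 11"
  by (auto simp: hands_def view_def observed_def)

text \<open>Conditionally on what Banker sees of the two hands, the score of one hand is independent of the
  other hand. This separates the double sum over hands into products of one-hand sums.\<close>
lemma sum_by_view:
  fixes w w' g r :: "bool \<times> nat \<times> nat \<Rightarrow> real"
  shows "(\<Sum>h\<in>hands. \<Sum>h'\<in>hands. w h * w' h' * (g h + c (view h) (view h') * r h)) =
    (\<Sum>k\<le>11. \<Sum>k'\<le>11. (\<Sum>h'\<in>{h \<in> hands. view h = k'}. w' h') *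
      ((\<Sum>h\<in>{h \<in> hands. view h = k}. w h * g h) + c k k' * (\<Sum>h\<in>{h \<in> hands. view h = k}. w h * r h)))"
proof -
  have fin: "finite hands" by (simp add: hands_def)
  have group: "(\<Sum>h\<in>hands. f h) = (\<Sum>k\<le>11. \<Sum>h\<in>{h \<in> hands. view h = k}. f h)" for f :: "bool \<times> nat \<times> nat \<Rightarrow> real"
    by (rule sum.group[symmetric]) (use fin view_le in auto)
  have "(\<Sum>h\<in>hands. \<Sum>h'\<in>hands. w h * w' h' * (g h + c (view h) (view h') * r h)) =
    (\<Sum>k\<le>11. \<Sum>h\<in>{h \<in> hands. view h = k}. \<Sum>k'\<le>11. \<Sum>h'\<in>{h \<in> hands. view h = k'}.
      w h * w' h' * (g h + c k k' * r h))"
    by (simp add: group)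
  also have "\<dots> = (\<Sum>k\<le>11. \<Sum>k'\<le>11. \<Sum>h\<in>{h \<in> hands. view h = k}. \<Sum>h'\<in>{h \<in> hands. view h = k'}.
      w h * w' h' * (g h + c k k' * r h))"
    by (subst sum.swap) simp
  also have "\<dots> = (\<Sum>k\<le>11. \<Sum>k'\<le>11. (\<Sum>h'\<in>{h \<in> hands. view h = k'}. w' h') *
      ((\<Sum>h\<in>{h \<in> hands. view h = k}. w h * g h) + c k k' * (\<Sum>h\<in>{h \<in> hands. view h = k}. w h * r h)))"
    by (intro sum.cong refl)
      (simp add: sum_distrib_left sum_distrib_right sum.distrib[symmetric] algebra_simps)
  finally show ?thesis .
qed

text \<open>Both players expect this from the deals in which Banker holds a natural, where no strategy
  matters.\<close>
definition banker_natural_gain :: real where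
  "banker_natural_gain = (\<Sum>y\<in>{8..9}. \<Sum>x\<le>9. pmf two_card_pmf y * pmf two_card_pmf x * sgn (real x - real y))"

lemma outcome_eq_hand_score:
  assumes "y \<le> 7"
  shows "outcome u x x' xo y b = hand_score b (u, x, x')"
  using assms by (auto simp: outcome_def hand_score_def showdown_def final_total_def sgn_if)

lemma sum_hand_weight:
  "(\<Sum>h\<in>hands. hand_weight p h) = 1"
  by (simp add: hands_def hand_weight_def sum.cartesian_product[symmetric]
     sum_distrib_left[symmetric] sum_pmf_third_card sum_pmf_two_card sum_pmf_bernoulli)

lemma sum_hand_weight_total:
  "(\<Sum>h\<in>hands. hand_weight p h * f (fst (snd h))) = (\<Sum>x\<le>9. pmf two_card_pmf x * f x)"
proof -
  have "(\<Sum>h\<in>hands. hand_weight p h * f (fst (snd h))) = (\<Sum>u\<in>UNIV. \<Sum>x\<le>9. \<Sum>x'\<le>9.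
      pmf (bernoulli_pmf p) u * (pmf two_card_pmf x * f x * pmf third_card_pmf x'))"
    by (simp add: hands_def hand_weight_def sum.cartesian_product' mult_ac)
  also have "\<dots> = (\<Sum>x\<le>9. pmf two_card_pmf x * f x)"
    by (simp only: sum_distrib_left[symmetric] sum_pmf_third_card mult_1_right)
       (simp only: sum_distrib_right[symmetric] sum_pmf_bernoulli mult_1_left)
  finally show ?thesis .
qed

lemma hand_score_natural:
  "h \<in> hands \<Longrightarrow> view h = 11 \<Longrightarrow> hand_score b h = 1"
  by (auto simp: hands_def view_def hand_score_def showdown_def observed_def split: if_splits)

lemma draw_effect_score:
  "(\<Sum>h\<in>{h \<in> hands. view h = k}. hand_weight p h * draw_effect (\<lambda>b. hand_score b h) j) =
   draw_effect (score p k) j"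
  unfolding draw_effect_def score_def
  by (simp add: sum_distrib_left right_diff_distrib sum_subtractf mult_ac)
     (rule sum.swap)

text \<open>Outside the information sets nothing is known about \<open>\<beta>\<close>, not even that its values are
  probabilities. For totals up to 7 this concerns two naturals only, where drawing changes nothing.\<close>
lemma expected_outcome:
  assumes "behavioral \<beta>" "y \<le> 7" and h: "(u1, x1, x1') \<in> hands" "(u2, x2, x2') \<in> hands"
  shows "(\<Sum>y'\<le>9. pmf third_card_pmf y' *
        (\<Sum>d\<in>UNIV. pmf (bernoulli_pmf (\<beta> (observed u1 x1 x1', observed u2 x2 x2', y))) d *
          outcome u1 x1 x1' x2 y (banker_total d y y'))) =
     hand_score y (u1, x1, x1') + \<beta> (observed u1 x1 x1', observed u2 x2 x2', y) *
       draw_effect (\<lambda>b. hand_score b (u1, x1, x1')) y"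
proof (cases "(observed u1 x1 x1', observed u2 x2 x2', y) \<in> info_sets")
  case True
  then have "\<beta> (observed u1 x1 x1', observed u2 x2 x2', y) \<in> {0..1}" (is "?b \<in> _")
    using assms(1) by (auto simp: behavioral_def)
  then have "(\<Sum>y'\<le>9. pmf third_card_pmf y' *
        (\<Sum>d\<in>UNIV. pmf (bernoulli_pmf ?b) d *
          outcome u1 x1 x1' x2 y (banker_total d y y'))) =
     (\<Sum>y'\<le>9. (1 - ?b) * hand_score y (u1, x1, x1') * pmf third_card_pmf y' +
        ?b * (pmf third_card_pmf y' * hand_score ((y + y') mod 10) (u1, x1, x1')))"
    by (intro sum.cong refl)
       (simp add: UNIV_bool outcome_eq_hand_score[OF \<open>y \<le> 7\<close>] banker_total_def algebra_simps)
  also have "\<dots> = (1 - ?b) * hand_score y (u1, x1, x1') +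
     ?b * (\<Sum>y'\<le>9. pmf third_card_pmf y' * hand_score ((y + y') mod 10) (u1, x1, x1'))"
    by (simp add: sum.distrib sum_distrib_left[symmetric] sum_pmf_third_card)
  finally show ?thesis
    by (simp add: draw_effect_def algebra_simps)
next
  case False
  have "view (u1, x1, x1') = 11"
    using False assms(2) view_le[OF h(1)] view_le[OF h(2)] by (auto simp: info_sets_def view_def)
  then have 1: "hand_score b (u1, x1, x1') = 1" for b
    using hand_score_natural h by blast
  show ?thesis
    by (simp add: outcome_eq_hand_score[OF \<open>y \<le> 7\<close>] 1 draw_effect_def sum_pmf_bernoulli sum_pmf_third_card)
qed

lemma expectation_first:
  assumes "behavioral \<beta>"
  shows "measure_pmf.expectation (play p1 p2 \<beta>) fst = banker_natural_gain +
    (\<Sum>y\<le>7. pmf two_card_pmf y * (\<Sum>k1\<le>11. \<Sum>k2\<le>11. seen p2 k2 *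
      (score p1 k1 y + \<beta> (k1, k2, y) * draw_effect (score p1 k1) y)))"
proof -
  define V where "V = (\<lambda>h1 h2 y. case h1 of (u1, x1, x1') \<Rightarrow> case h2 of (u2, x2, x2') \<Rightarrow>
     (\<Sum>y'\<le>9. pmf third_card_pmf y' *
        (\<Sum>d\<in>UNIV. pmf (bernoulli_pmf (\<beta> (observed u1 x1 x1', observed u2 x2 x2', y))) d *
          outcome u1 x1 x1' x2 y (banker_total d y y'))))"
  have split: "{..9::nat} = {8..9} \<union> {..7}" by auto
  have "measure_pmf.expectation (play p1 p2 \<beta>) fst =
     (\<Sum>h1\<in>hands. \<Sum>h2\<in>hands. \<Sum>y\<le>9. hand_weight p1 h1 * hand_weight p2 h2 * pmf two_card_pmf y * V h1 h2 y)"
    using expectation_play[of p1 p2 \<beta> "\<lambda>g1 g2. g1"] by (simp add: case_prod_unfold V_def)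
  also have "\<dots> = (\<Sum>h1\<in>hands. \<Sum>y\<le>9. \<Sum>h2\<in>hands. hand_weight p1 h1 * hand_weight p2 h2 * pmf two_card_pmf y * V h1 h2 y)"
    by (intro sum.cong refl sum.swap)
  also have "\<dots> = (\<Sum>y\<le>9. pmf two_card_pmf y *
      (\<Sum>h1\<in>hands. \<Sum>h2\<in>hands. hand_weight p1 h1 * hand_weight p2 h2 * V h1 h2 y))"
    by (subst sum.swap) (simp add: sum_distrib_left mult_ac)
  also have "\<dots> = (\<Sum>y\<in>{8..9}. pmf two_card_pmf y *
      (\<Sum>h1\<in>hands. \<Sum>h2\<in>hands. hand_weight p1 h1 * hand_weight p2 h2 * V h1 h2 y)) +
     (\<Sum>y\<le>7. pmf two_card_pmf y *
      (\<Sum>h1\<in>hands. \<Sum>h2\<in>hands. hand_weight p1 h1 * hand_weight p2 h2 * V h1 h2 y))"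
    unfolding split by (subst sum.union_disjoint) auto
  also have "(\<Sum>y\<in>{8..9}. pmf two_card_pmf y *
      (\<Sum>h1\<in>hands. \<Sum>h2\<in>hands. hand_weight p1 h1 * hand_weight p2 h2 * V h1 h2 y)) = banker_natural_gain"
    unfolding banker_natural_gain_def
  proof (intro sum.cong refl)
    fix y :: nat assume y: "y \<in> {8..9}"
    have "V h1 h2 y = sgn (real (fst (snd h1)) - real y)" for h1 h2
      using y by (simp add: V_def case_prod_unfold outcome_def sum_pmf_bernoulli sum_pmf_third_card
        sum_distrib_right[symmetric])
    then have "(\<Sum>h1\<in>hands. \<Sum>h2\<in>hands. hand_weight p1 h1 * hand_weight p2 h2 * V h1 h2 y) =
       (\<Sum>h1\<in>hands. hand_weight p1 h1 * sgn (real (fst (snd h1)) - real y)) * (\<Sum>h2\<in>hands. hand_weight p2 h2)"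
      by (simp add: sum_distrib_left sum_distrib_right mult_ac)
    also have "\<dots> = (\<Sum>x\<le>9. pmf two_card_pmf x * sgn (real x - real y))"
      by (simp add: sum_hand_weight sum_hand_weight_total[where f = "\<lambda>x. sgn (real x - real y)"])
    finally show "pmf two_card_pmf y *
        (\<Sum>h1\<in>hands. \<Sum>h2\<in>hands. hand_weight p1 h1 * hand_weight p2 h2 * V h1 h2 y) =
      (\<Sum>x\<le>9. pmf two_card_pmf y * pmf two_card_pmf x * sgn (real x - real y))"
      by (simp add: sum_distrib_left mult_ac)
  qed
  also have "(\<Sum>y\<le>7. pmf two_card_pmf y *
      (\<Sum>h1\<in>hands. \<Sum>h2\<in>hands. hand_weight p1 h1 * hand_weight p2 h2 * V h1 h2 y)) =
    (\<Sum>y\<le>7. pmf two_card_pmf y * (\<Sum>k1\<le>11. \<Sum>k2\<le>11. seen p2 k2 *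
      (score p1 k1 y + \<beta> (k1, k2, y) * draw_effect (score p1 k1) y)))"
  proof (intro sum.cong refl arg_cong2[where f = "(*)"])
    fix y :: nat assume y: "y \<in> {..7}"
    have "V h1 h2 y = hand_score y h1 + \<beta> (view h1, view h2, y) * draw_effect (\<lambda>b. hand_score b h1) y"
      if "h1 \<in> hands" "h2 \<in> hands" for h1 h2
      using expected_outcome[OF assms, of y] that y
      by (cases h1; cases h2) (simp add: V_def view_def)
    then show "(\<Sum>h1\<in>hands. \<Sum>h2\<in>hands. hand_weight p1 h1 * hand_weight p2 h2 * V h1 h2 y) =
      (\<Sum>k1\<le>11. \<Sum>k2\<le>11. seen p2 k2 *
        (score p1 k1 y + \<beta> (k1, k2, y) * draw_effect (score p1 k1) y))"
      by (simp add: sum_by_view[of "hand_weight p1" "hand_weight p2" "hand_score y"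
         "\<lambda>k k'. \<beta> (k, k', y)"] draw_effect_score score_def[symmetric] seen_def[symmetric])
  qed
  finally show ?thesis .
qed

section \<open>One-hand sums\<close>

definition view_sum :: "real \<Rightarrow> nat \<Rightarrow> (nat \<Rightarrow> nat \<Rightarrow> real) \<Rightarrow> real" where
  "view_sum p k G =
     (if k \<le> 9 then pmf third_card_pmf k *
        ((\<Sum>x\<le>4. pmf two_card_pmf x * G x ((x + k) mod 10)) +
         p * pmf two_card_pmf 5 * G 5 ((5 + k) mod 10))
      else if k = 10 then (1 - p) * pmf two_card_pmf 5 * G 5 5 +
         (\<Sum>x\<in>{6..7}. pmf two_card_pmf x * G x x)
      else (\<Sum>x\<in>{8..9}. pmf two_card_pmf x * G x x))"

text \<open>A third-card value that is observed determines the third card, and a stand or a natural leaves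
  it free, in which case its probabilities add up to 1.\<close>
lemma sum_over_view:
  assumes p: "p \<in> {0..1}" and "k \<le> 11"
  shows "(\<Sum>h\<in>{h \<in> hands. view h = k}. hand_weight p h * (case h of (u, x, x') \<Rightarrow> G x (final_total u x x'))) =
    view_sum p k G"
proof -
  have third: "(\<Sum>x'\<le>9. pmf third_card_pmf x' *
        (if observed u x x' = k then G x (final_total u x x') else 0)) =
      (if player_draws u x then if k \<le> 9 then pmf third_card_pmf k * G x ((x + k) mod 10) else 0
       else if k = (if x \<le> 7 then 10 else 11) then G x x else 0)" for u x
  proof (cases "player_draws u x")
    case True
    then have "(\<Sum>x'\<le>9. pmf third_card_pmf x' *
        (if observed u x x' = k then G x (final_total u x x') else 0)) =
      (\<Sum>x'\<le>9. if k = x' then pmf third_card_pmf k * G x ((x + k) mod 10) else 0)"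
      by (intro sum.cong) (auto simp: observed_def final_total_def)
    then show ?thesis
      using True by simp
  next
    case False
    then show ?thesis
      by (auto simp: observed_def final_total_def sum_distrib_right[symmetric] sum_pmf_third_card)
  qed
  have "(\<Sum>h\<in>{h \<in> hands. view h = k}. hand_weight p h * (case h of (u, x, x') \<Rightarrow> G x (final_total u x x'))) =
     (\<Sum>h\<in>hands. hand_weight p h *
        (case h of (u, x, x') \<Rightarrow> if observed u x x' = k then G x (final_total u x x') else 0))"
    by (subst sum.inter_filter) (auto simp: hands_def view_def intro!: sum.cong)
  also have "\<dots> = (\<Sum>u\<in>UNIV. \<Sum>x\<le>9. pmf (bernoulli_pmf p) u * pmf two_card_pmf x *
      (\<Sum>x'\<le>9. pmf third_card_pmf x' *
        (if observed u x x' = k then G x (final_total u x x') else 0)))"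
    by (simp add: hands_def hand_weight_def sum.cartesian_product' sum_distrib_left mult_ac)
  also have "\<dots> = view_sum p k G"
  proof -
    have nums: "{..9::nat} = {0,1,2,3,4,5,6,7,8,9}" "{..4::nat} = {0,1,2,3,4}"
       "{6..7::nat} = {6,7}" "{8..9::nat} = {8,9}" by auto
    show ?thesis
      using p \<open>k \<le> 11\<close> unfolding third
      by (simp add: UNIV_bool nums player_draws_def view_sum_def algebra_simps)
  qed
  finally show ?thesis .
qed

lemma seen_eq: "p \<in> {0..1} \<Longrightarrow> k \<le> 11 \<Longrightarrow> seen p k = view_sum p k (\<lambda>_ _. 1)"
  using sum_over_view[of p k "\<lambda>_ _. 1"] by (simp add: seen_def case_prod_unfold)

lemma score_eq: "p \<in> {0..1} \<Longrightarrow> k \<le> 11 \<Longrightarrow> score p k b = view_sum p k (\<lambda>x f. of_int (showdown b x f))"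
  using sum_over_view[of p k "\<lambda>x f. of_int (showdown b x f)"] by (simp add: score_def hand_score_def)

text \<open>Only on a two-card total of 5 does the probability of drawing matter. Raising it moves
  mass from the stand with 5 to the hands that draw on 5.\<close>
definition score_slope :: "nat \<Rightarrow> nat \<Rightarrow> real" where
  "score_slope k b = pmf two_card_pmf 5 *
     (if k \<le> 9 then pmf third_card_pmf k * of_int (showdown b 5 ((5 + k) mod 10))
      else if k = 10 then - of_int (showdown b 5 5) else 0)"

lemma score_affine: "p \<in> {0..1} \<Longrightarrow> k \<le> 11 \<Longrightarrow> score p k b = score 0 k b + p * score_slope k b"
  by (simp add: score_eq view_sum_def score_slope_def algebra_simps)

section \<open>Payoffs and best responses\<close>

text \<open>For \<open>f\<close> the scores of a player, this is what he gains in the deals where Banker holds no natural,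
  \<open>p\<close> being the opponent's probability of drawing on 5. It is linear in \<open>f\<close>, which lets the same
  expression with \<open>score_slope\<close> for \<open>f\<close> describe the player's incentive to draw on 5.\<close>
definition vs_banker :: "real \<Rightarrow> banker_strategy \<Rightarrow> (nat \<Rightarrow> nat \<Rightarrow> real) \<Rightarrow> real" where
  "vs_banker p \<beta> f = (\<Sum>y\<le>7. pmf two_card_pmf y * (\<Sum>k1\<le>11. \<Sum>k2\<le>11. seen p k2 *
      (f k1 y + \<beta> (k1, k2, y) * draw_effect (f k1) y)))"

lemma vs_banker_add:
  assumes "\<And>k b. k \<le> 11 \<Longrightarrow> h k b = f k b + c * g k b"
  shows "vs_banker p \<beta> h = vs_banker p \<beta> f + c * vs_banker p \<beta> g"
proof -
  have "draw_effect (h k) y = draw_effect (f k) y + c * draw_effect (g k) y" if "k \<le> 11" for k y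
    using that by (simp add: assms draw_effect_def algebra_simps sum.distrib sum_distrib_left)
  then have "vs_banker p \<beta> h = (\<Sum>y\<le>7. \<Sum>k1\<le>11. \<Sum>k2\<le>11. pmf two_card_pmf y * (seen p k2 *
      ((f k1 y + c * g k1 y) + \<beta> (k1, k2, y) * (draw_effect (f k1) y + c * draw_effect (g k1) y))))"
    by (simp add: vs_banker_def assms sum_distrib_left)
  also have "\<dots> = vs_banker p \<beta> f + c * vs_banker p \<beta> g"
    by (simp add: vs_banker_def sum_distrib_left sum.distrib[symmetric] algebra_simps)
  finally show ?thesis .
qed

lemma vs_banker_cong:
  assumes "\<And>k1 k2 y. k1 \<le> 11 \<Longrightarrow> k2 \<le> 11 \<Longrightarrow> y \<le> 7 \<Longrightarrow> \<beta> (k1, k2, y) = \<beta>' (k1, k2, y)"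
  shows "vs_banker p \<beta> f = vs_banker p \<beta>' f"
  by (simp add: vs_banker_def assms)

lemma vs_banker_update:
  assumes "k1 \<le> 11" "k2 \<le> 11" "y \<le> 7"
  shows "vs_banker p (\<beta>((k1, k2, y) := a)) f =
    vs_banker p \<beta> f + (a - \<beta> (k1, k2, y)) * pmf two_card_pmf y * seen p k2 * draw_effect (f k1) y"
proof -
  let ?d = "(a - \<beta> (k1, k2, y)) * pmf two_card_pmf y * seen p k2 * draw_effect (f k1) y"
  have "vs_banker p (\<beta>((k1, k2, y) := a)) f =
    (\<Sum>y'\<le>7. \<Sum>k1'\<le>11. \<Sum>k2'\<le>11. pmf two_card_pmf y' * (seen p k2' *
      (f k1' y' + \<beta> (k1', k2', y') * draw_effect (f k1') y')) +
      (if k2' = k2 then if k1' = k1 then if y' = y then ?d else 0 else 0 else 0))"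
    unfolding vs_banker_def sum_distrib_left
    by (intro sum.cong refl) (auto simp: algebra_simps)
  also have "\<dots> = vs_banker p \<beta> f + ?d"
    using assms by (simp add: vs_banker_def sum_distrib_left sum.distrib)
  finally show ?thesis .
qed

lemma behavioral_mirrored: "behavioral \<beta> \<Longrightarrow> behavioral (mirrored \<beta>)"
  by (auto simp: behavioral_def mirrored_def info_sets_def)

lemma payoff1_eq:
  assumes "behavioral \<beta>"
  shows "payoff1 \<theta> p1 p2 \<beta> = \<theta> * (banker_natural_gain + vs_banker p2 \<beta> (score p1))"
  using expectation_first[OF assms, of p1 p2]
  by (simp add: payoff1_def vs_banker_def case_prod_unfold)

lemma payoff2_eq:
  assumes "behavioral \<beta>"
  shows "payoff2 \<theta> p1 p2 \<beta> = (1 - \<theta>) * (banker_natural_gain + vs_banker p1 (mirrored \<beta>) (score p2))"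
  using expectation_first[OF behavioral_mirrored[OF assms], of p2 p1]
  by (simp add: payoff2_def vs_banker_def case_prod_unfold expectation_second)

lemma banker_payoff_zero_sum:
  "banker_payoff \<theta> p1 p2 \<beta> = - (payoff1 \<theta> p1 p2 \<beta> + payoff2 \<theta> p1 p2 \<beta>)"
proof -
  have "finite (set_pmf (play p1 p2 \<beta>))"
    by (simp add: play_def Let_def finite_set_two_card finite_set_third_card)
  then have "integrable (measure_pmf (play p1 p2 \<beta>)) f" for f :: "real \<times> real \<Rightarrow> real"
    by (rule integrable_measure_pmf_finite)
  then show ?thesis
    by (simp add: banker_payoff_def payoff1_def payoff2_def case_prod_unfold)
qed

text \<open>What drawing instead of standing on \<open>j\<close> costs Banker at an information set, up to the probability
  of his total. Either player contributes his own swing, weighted with the probability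
  of the other player's view.\<close>
definition draw_cost :: "real \<Rightarrow> real \<Rightarrow> real \<Rightarrow> nat \<Rightarrow> nat \<Rightarrow> nat \<Rightarrow> real" where
  "draw_cost \<theta> p1 p2 k1 k2 j =
     \<theta> * seen p2 k2 * draw_effect (score p1 k1) j + (1 - \<theta>) * seen p1 k1 * draw_effect (score p2 k2) j"

text \<open>Banker's payoff is affine in each drawing probability, without interaction between different
  information sets, because at most one of them is met in a play.\<close>
lemma banker_payoff_diff:
  assumes "behavioral \<beta>" "behavioral \<beta>'"
  shows "banker_payoff \<theta> p1 p2 \<beta> - banker_payoff \<theta> p1 p2 \<beta>' =
    (\<Sum>y\<le>7. \<Sum>k1\<le>11. \<Sum>k2\<le>11. pmf two_card_pmf y *
       ((\<beta>' (k1, k2, y) - \<beta> (k1, k2, y)) * draw_cost \<theta> p1 p2 k1 k2 y))"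
proof -
  have 1: "vs_banker p2 \<beta>' (score p1) - vs_banker p2 \<beta> (score p1) =
     (\<Sum>y\<le>7. \<Sum>k1\<le>11. \<Sum>k2\<le>11. pmf two_card_pmf y *
       ((\<beta>' (k1, k2, y) - \<beta> (k1, k2, y)) * (seen p2 k2 * draw_effect (score p1 k1) y)))"
    by (simp add: vs_banker_def sum_distrib_left sum_subtractf[symmetric] algebra_simps)
  have "vs_banker p1 (mirrored \<beta>') (score p2) - vs_banker p1 (mirrored \<beta>) (score p2) =
     (\<Sum>y\<le>7. \<Sum>k1\<le>11. \<Sum>k2\<le>11. pmf two_card_pmf y *
       ((\<beta>' (k2, k1, y) - \<beta> (k2, k1, y)) * (seen p1 k2 * draw_effect (score p2 k1) y)))"
    by (simp add: vs_banker_def mirrored_def sum_distrib_left sum_subtractf[symmetric] algebra_simps)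
  also have "\<dots> = (\<Sum>y\<le>7. \<Sum>k1\<le>11. \<Sum>k2\<le>11. pmf two_card_pmf y *
       ((\<beta>' (k1, k2, y) - \<beta> (k1, k2, y)) * (seen p1 k1 * draw_effect (score p2 k2) y)))"
    by (intro sum.cong refl sum.swap)
  finally have 2: "vs_banker p1 (mirrored \<beta>') (score p2) - vs_banker p1 (mirrored \<beta>) (score p2) = \<dots>" .
  have "banker_payoff \<theta> p1 p2 \<beta> - banker_payoff \<theta> p1 p2 \<beta>' =
     \<theta> * (vs_banker p2 \<beta>' (score p1) - vs_banker p2 \<beta> (score p1)) +
     (1 - \<theta>) * (vs_banker p1 (mirrored \<beta>') (score p2) - vs_banker p1 (mirrored \<beta>) (score p2))"
    by (simp add: banker_payoff_zero_sum payoff1_eq payoff2_eq assms algebra_simps)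
  also have "\<dots> = (\<Sum>y\<le>7. \<Sum>k1\<le>11. \<Sum>k2\<le>11. pmf two_card_pmf y *
       ((\<beta>' (k1, k2, y) - \<beta> (k1, k2, y)) * draw_cost \<theta> p1 p2 k1 k2 y))"
    unfolding 1 2
    by (simp add: sum_distrib_left sum.distrib[symmetric] draw_cost_def algebra_simps)
  finally show ?thesis .
qed

text \<open>A payoff that is affine in a probability is maximal at an interior point only if it is constant.
  The stakes \<open>\<theta>\<close> and \<open>1 - \<theta>\<close> scale the payoffs and drop out, which is why the equilibrium
  conditions on the drawing probabilities do not depend on \<open>\<theta>\<close>.\<close>
lemma player_optimal_iff:
  assumes \<theta>: "0 < \<theta>" "\<theta> < 1" and \<beta>: "behavioral \<beta>" and p: "0 < p1" "p1 < 1" "0 < p2" "p2 < 1"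
  shows "(\<forall>p\<in>{0..1}. payoff1 \<theta> p p2 \<beta> \<le> payoff1 \<theta> p1 p2 \<beta>) \<longleftrightarrow> vs_banker p2 \<beta> score_slope = 0"
    and "(\<forall>p\<in>{0..1}. payoff2 \<theta> p1 p \<beta> \<le> payoff2 \<theta> p1 p2 \<beta>) \<longleftrightarrow> vs_banker p1 (mirrored \<beta>) score_slope = 0"
proof -
  have crit: "(\<forall>p\<in>{0..1}. t * (n + (a + p * s)) \<le> t * (n + (a + q * s))) \<longleftrightarrow> s = 0"
    if "0 < t" "0 < q" "q < 1" for t n a q s :: real
  proof
    assume "\<forall>p\<in>{0..1}. t * (n + (a + p * s)) \<le> t * (n + (a + q * s))"
    then have *: "p * s \<le> q * s" if "p \<in> {0..1}" for p
      using \<open>0 < t\<close> that by auto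
    have "0 \<le> q * s" "0 \<le> (q - 1) * s"
      using *[of 0] *[of 1] by (simp_all add: left_diff_distrib)
    then show "s = 0"
      using that by (simp add: zero_le_mult_iff)
  qed simp
  have affine: "vs_banker q \<gamma> (score p) = vs_banker q \<gamma> (score 0) + p * vs_banker q \<gamma> score_slope"
    if "p \<in> {0..1}" for p q \<gamma>
    by (rule vs_banker_add) (simp add: score_affine[OF that])
  have "payoff1 \<theta> p p2 \<beta> = \<theta> * (banker_natural_gain + (vs_banker p2 \<beta> (score 0) + p * vs_banker p2 \<beta> score_slope))"
    if "p \<in> {0..1}" for p
    using affine[OF that] by (simp only: payoff1_eq[OF \<beta>])
  then show "(\<forall>p\<in>{0..1}. payoff1 \<theta> p p2 \<beta> \<le> payoff1 \<theta> p1 p2 \<beta>) \<longleftrightarrow> vs_banker p2 \<beta> score_slope = 0"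
    using crit[OF \<open>0 < \<theta>\<close> p(1,2)] p by simp
  have "payoff2 \<theta> p1 p \<beta> = (1 - \<theta>) *
      (banker_natural_gain + (vs_banker p1 (mirrored \<beta>) (score 0) + p * vs_banker p1 (mirrored \<beta>) score_slope))"
    if "p \<in> {0..1}" for p
    using affine[OF that] by (simp only: payoff2_eq[OF \<beta>])
  then show "(\<forall>p\<in>{0..1}. payoff2 \<theta> p1 p \<beta> \<le> payoff2 \<theta> p1 p2 \<beta>) \<longleftrightarrow> vs_banker p1 (mirrored \<beta>) score_slope = 0"
    using crit[of "1 - \<theta>" p2] p \<theta> by simp
qed

section \<open>Exact integer computations\<close>

definition two_card_count :: "nat \<Rightarrow> int" where
  "two_card_count x = (if x = 0 then 25 else 16)"

definition third_card_count :: "nat \<Rightarrow> int" where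
  "third_card_count x = (if x = 0 then 4 else 1)"

text \<open>One-hand sums at the mixture \<open>9/11\<close>, in units of \<open>1/24167\<close>, where \<open>24167 = 11 * 13 ^ 3\<close>
  is the common denominator of the mixture, the two-card and the third-card weights.\<close>
definition view_count :: "nat \<Rightarrow> (nat \<Rightarrow> nat \<Rightarrow> int) \<Rightarrow> int" where
  "view_count k G =
     (if k \<le> 9 then third_card_count k *
        (11 * (\<Sum>x\<leftarrow>[0..<5]. two_card_count x * G x ((x + k) mod 10)) +
         9 * two_card_count 5 * G 5 ((5 + k) mod 10))
      else if k = 10 then 13 * (2 * two_card_count 5 * G 5 5 + 11 * two_card_count 6 * G 6 6 + 11 * two_card_count 7 * G 7 7)
      else 143 * (two_card_count 8 * G 8 8 + two_card_count 9 * G 9 9))"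

text \<open>In units of \<open>1/13\<close>, the denominator of Banker's third card.\<close>
definition draw_effect_count :: "(nat \<Rightarrow> int) \<Rightarrow> nat \<Rightarrow> int" where
  "draw_effect_count f j = (\<Sum>y'\<leftarrow>[0..<10]. third_card_count y' * f ((j + y') mod 10)) - 13 * f j"

text \<open>For each view (rows, the last two being a stand and a natural) and each total of Banker, the
  change in a player's score if Banker draws, in units of \<open>1/314171\<close> with
  \<open>314171 = 13 * 24167\<close>. The 0 in the row of a stand is the reason for
  the mixture \<open>9/11\<close>: it makes Banker indifferent on 6 against a player who stands.\<close>
definition swing_table :: "int list list" where
  "swing_table =
    [[-54508,-36468,-22388,-8308,5772,18572,24332,24332],
     [-14131,-11381,-6871,-3351,169,3689,6889,8329],
     [-11885,-11885,-9135,-4625,-1105,2415,5935,9135],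
     [-9639,-9639,-9639,-6889,-2379,1141,4661,8181],
     [-7393,-7393,-7393,-7393,-4643,-133,3387,6907],
     [-6587,-5147,-5147,-5147,-5147,-2397,2113,5633],
     [-7541,-4341,-2901,-2901,-2901,-2901,-151,4359],
     [-8815,-5295,-2095,-655,-655,-655,-655,2095],
     [-10089,-6569,-3049,151,1591,1591,1591,1591],
     [-11363,-7843,-4323,-803,2397,3837,3837,3837],
     [-31200,-31200,-31200,-31200,-31200,-27040,0,45760],
     [0,0,0,0,0,0,0,0]]"

definition seen_table :: "int list" where
  "seen_table = [4492,1123,1123,1123,1123,1123,1123,1123,1123,1123,4992,4576]"

lemma swing_table_correct:
  "map (\<lambda>k. map (draw_effect_count (\<lambda>b. view_count k (showdown b))) [0..<8]) [0..<12] = swing_table"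
  by code_simp

lemma seen_table_correct:
  "map (\<lambda>k. view_count k (\<lambda>_ _. 1)) [0..<12] = seen_table"
  by code_simp

lemma seen_table_nth: "k \<le> 11 \<Longrightarrow> seen_table ! k = view_count k (\<lambda>_ _. 1)"
  by (simp del: upt_Suc upt_rec_numeral flip: seen_table_correct)

lemma swing_table_nth:
  "k \<le> 11 \<Longrightarrow> j \<le> 7 \<Longrightarrow> swing_table ! k ! j = draw_effect_count (\<lambda>b. view_count k (showdown b)) j"
  by (simp del: upt_Suc upt_rec_numeral flip: swing_table_correct)

text \<open>The integers \<open>a\<close> and \<open>b\<close> are proportional to the stakes on the two players.\<close>
definition entry_optimal :: "int \<Rightarrow> int \<Rightarrow> nat \<Rightarrow> nat \<Rightarrow> nat \<Rightarrow> bool" where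
  "entry_optimal a b k1 k2 j \<longleftrightarrow>
     (let c = a * seen_table ! k2 * swing_table ! k1 ! j + b * seen_table ! k1 * swing_table ! k2 ! j
      in if j \<le> table_N ! k1 ! k2 then c \<le> 0 else 0 \<le> c)"

text \<open>The cost of drawing is affine in \<open>\<theta>\<close>, so its sign on an interval need only be tested at the
  endpoints: equal stakes for \<open>\<theta> = 1/2\<close>, and stakes in the proportion \<open>799 : 805\<close> for
  \<open>\<theta> = 799/1604\<close>. The latter value is where the cost at \<open>(2, 5, 5)\<close> vanishes:
  \<open>799 * 1123 * 2415 = 805 * 1123 * 2397\<close>.\<close>
lemma entries_optimal:
  assumes "(a, b) \<in> {(1, 1), (799, 805)}" "k1 \<le> 11" "k2 \<le> 11" "j \<le> 7"
  shows "entry_optimal a b k1 k2 j"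
proof -
  have "\<forall>(a, b) \<in> set [(1, 1), (799, 805)]. \<forall>k1 \<in> set [0..<12]. \<forall>k2 \<in> set [0..<12]. \<forall>j \<in> set [0..<8]. entry_optimal a b k1 k2 j"
    by code_simp
  then show ?thesis
    using assms by (simp del: upt_Suc upt_rec_numeral) force
qed

lemma table_N_symmetric:
  assumes "k1 \<le> 11" "k2 \<le> 11"
  shows "table_N ! k1 ! k2 = table_N ! k2 ! k1"
proof -
  have "\<forall>k1 \<in> set [0..<12]. \<forall>k2 \<in> set [0..<12]. table_N ! k1 ! k2 = table_N ! k2 ! k1"
    by code_simp
  then show ?thesis
    using assms by (simp del: upt_Suc upt_rec_numeral)
qed

text \<open>The numerator of \<open>vs_banker\<close> against the table strategy that stands at the three exceptional
  information sets. The sum over the opponent's views is carried out separately for the standing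
  and the drawing part; without Banker's drawing it is the total mass 24167.\<close>
definition vs_banker_count :: "(nat \<Rightarrow> nat \<Rightarrow> int) \<Rightarrow> int" where
  "vs_banker_count F = (\<Sum>y\<leftarrow>[0..<8]. two_card_count y * (\<Sum>k1\<leftarrow>[0..<12].
     13 * 24167 * F k1 y + draw_effect_count (F k1) y *
       (\<Sum>k2\<leftarrow>[0..<12]. if y \<le> table_N ! k1 ! k2 then seen_table ! k2 else 0)))"

definition slope_count :: "nat \<Rightarrow> nat \<Rightarrow> int" where
  "slope_count k b =
     (if k \<le> 9 then third_card_count k * showdown b 5 ((5 + k) mod 10)
      else if k = 10 then - 13 * showdown b 5 5 else 0)"

lemma slope_count_total: "vs_banker_count slope_count = 6715965"
  by code_simp

lemma score_count_total: "vs_banker_count (\<lambda>k b. view_count k (showdown b)) = 185819366736"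
  by code_simp

lemma pmf_two_count: "x \<le> 9 \<Longrightarrow> pmf two_card_pmf x = of_int (two_card_count x) / 169"
  by (simp add: pmf_two_card two_card_count_def)

lemma pmf_third_count: "x \<le> 9 \<Longrightarrow> pmf third_card_pmf x = of_int (third_card_count x) / 13"
  by (simp add: pmf_third_card third_card_count_def)

lemma sum_upt: "(\<Sum>x\<leftarrow>[0..<Suc n]. f x) = (\<Sum>x\<le>n. f x)"
  by (simp only: interv_sum_list_conv_sum_set_nat set_upt atLeast0LessThan lessThan_Suc_atMost)

lemma sum_upt_le:
  "(\<Sum>x\<leftarrow>[0..<5]. f x) = (\<Sum>x\<le>4. f x)" "(\<Sum>x\<leftarrow>[0..<8]. f x) = (\<Sum>x\<le>7. f x)"
  "(\<Sum>x\<leftarrow>[0..<10]. f x) = (\<Sum>x\<le>9. f x)" "(\<Sum>x\<leftarrow>[0..<12]. f x) = (\<Sum>x\<le>11. f x)"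
  using sum_upt[of f 4] sum_upt[of f 7] sum_upt[of f 9] sum_upt[of f 11]
  by (simp_all del: upt_Suc upt_rec_numeral sum.atMost_Suc)

lemma view_sum_count:
  assumes "k \<le> 11"
  shows "view_sum (9/11) k (\<lambda>x f. of_int (G x f)) = of_int (view_count k G) / 24167"
proof -
  have nums: "{..4::nat} = {0,1,2,3,4}" "{6..7::nat} = {6,7}" "{8..9::nat} = {8,9}" by auto
  show ?thesis
    using assms unfolding view_sum_def view_count_def sum_upt_le nums
    by (simp add: pmf_two_count pmf_third_count field_simps)
qed

lemma seen_count: "k \<le> 11 \<Longrightarrow> seen (9/11) k = of_int (seen_table ! k) / 24167"
  using view_sum_count[of k "\<lambda>_ _. 1"] by (simp add: seen_eq seen_table_nth)

lemma score_count: "k \<le> 11 \<Longrightarrow> score (9/11) k b = 1 / 24167 * of_int (view_count k (showdown b))"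
  by (simp add: score_eq view_sum_count)

lemma slope_count: "k \<le> 11 \<Longrightarrow> score_slope k b = 16 / 2197 * of_int (slope_count k b)"
  by (simp add: score_slope_def slope_count_def pmf_two_count pmf_third_count two_card_count_def)

lemma draw_effect_count:
  assumes "\<And>b. f b = c * of_int (F b)"
  shows "draw_effect f j = c / 13 * of_int (draw_effect_count F j)"
proof -
  have "(\<Sum>y'\<le>9. pmf third_card_pmf y' * f ((j + y') mod 10)) =
     (\<Sum>y'\<le>9. c / 13 * of_int (third_card_count y' * F ((j + y') mod 10)))"
    by (intro sum.cong refl) (simp add: assms pmf_third_count)
  then show ?thesis
    by (simp add: draw_effect_def draw_effect_count_def sum_upt_le assms sum_distrib_left algebra_simps)
qed

lemma swing_count:
  "k \<le> 11 \<Longrightarrow> j \<le> 7 \<Longrightarrow> draw_effect (score (9/11) k) j = of_int (swing_table ! k ! j) / 314171"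
  using draw_effect_count[of "score (9/11) k" "1 / 24167" "\<lambda>b. view_count k (showdown b)" j]
  by (simp add: swing_table_nth score_count)

lemma table_strategy_base:
  "k1 \<le> 11 \<Longrightarrow> k2 \<le> 11 \<Longrightarrow> table_strategy 0 0 0 (k1, k2, j) = of_bool (j \<le> table_N ! k1 ! k2)"
  by (auto simp: table_strategy_def table_N_def)

lemma vs_banker_count:
  assumes "\<And>k b. k \<le> 11 \<Longrightarrow> f k b = c * of_int (F k b)"
  shows "vs_banker (9/11) (table_strategy 0 0 0) f = c / (169 * 24167 * 13) * of_int (vs_banker_count F)"
proof -
  have total: "(\<Sum>k\<le>11. of_int (seen_table ! k)) = (24167 :: real)"
    by (simp add: numeral_eq_Suc seen_table_def)
  define E where "E k1 y = 13 * 24167 * F k1 y + draw_effect_count (F k1) y *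
       (\<Sum>k2\<le>11. if y \<le> table_N ! k1 ! k2 then seen_table ! k2 else 0)" for k1 y
  have row: "(\<Sum>k2\<le>11. seen (9/11) k2 * (f k1 y + table_strategy 0 0 0 (k1, k2, y) * draw_effect (f k1) y)) =
     c / (24167 * 13) * of_int (E k1 y)" if "k1 \<le> 11" for k1 y
  proof -
    have "(\<Sum>k2\<le>11. seen (9/11) k2 * (f k1 y + table_strategy 0 0 0 (k1, k2, y) * draw_effect (f k1) y)) =
      (\<Sum>k2\<le>11. of_int (seen_table ! k2) * (c / 24167 * of_int (F k1 y)) +
         c / (24167 * 13) * of_int (draw_effect_count (F k1) y) *
           of_int (if y \<le> table_N ! k1 ! k2 then seen_table ! k2 else 0))"
      using that
      by (intro sum.cong refl)
        (simp add: seen_count table_strategy_base assms draw_effect_count[OF assms] field_simps)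
    also have "\<dots> = 24167 * (c / 24167 * of_int (F k1 y)) + c / (24167 * 13) * of_int (draw_effect_count (F k1) y) *
       of_int (\<Sum>k2\<le>11. if y \<le> table_N ! k1 ! k2 then seen_table ! k2 else 0)"
      by (simp only: sum.distrib sum_distrib_left[symmetric] sum_distrib_right[symmetric] total of_int_sum)
    finally show ?thesis
      by (simp add: E_def field_simps del: of_int_sum)
  qed
  have "vs_banker (9/11) (table_strategy 0 0 0) f =
      (\<Sum>y\<le>7. pmf two_card_pmf y * (\<Sum>k1\<le>11. c / (24167 * 13) * of_int (E k1 y)))"
    by (simp add: vs_banker_def row)
  also have "\<dots> = (\<Sum>y\<le>7. c / (169 * 24167 * 13) * of_int (two_card_count y * (\<Sum>k1\<le>11. E k1 y)))"
    by (intro sum.cong refl) (simp add: pmf_two_count sum_distrib_left mult_ac)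
  also have "\<dots> = c / (169 * 24167 * 13) * of_int (vs_banker_count F)"
    by (simp only: vs_banker_count_def sum_upt_le E_def sum_distrib_left of_int_sum)
  finally show ?thesis .
qed

section \<open>The equilibria\<close>

lemma table_strategy_update:
  "table_strategy r1 r2 r3 =
    (table_strategy 0 0 0)((10, 10, 6) := r1, (10, 11, 6) := r2, (11, 10, 6) := r3)"
  by (auto simp: table_strategy_def fun_eq_iff)

lemma behavioral_table_strategy:
  "behavioral (table_strategy r1 r2 r3) \<longleftrightarrow> r1 \<in> {0..1} \<and> r2 \<in> {0..1} \<and> r3 \<in> {0..1}"
proof
  assume "behavioral (table_strategy r1 r2 r3)"
  then have "table_strategy r1 r2 r3 s \<in> {0..1}" if "s \<in> info_sets" for s
    using that by (simp add: behavioral_def)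
  from this[of "(10, 10, 6)"] this[of "(10, 11, 6)"] this[of "(11, 10, 6)"]
  show "r1 \<in> {0..1} \<and> r2 \<in> {0..1} \<and> r3 \<in> {0..1}"
    by (simp add: info_sets_def table_strategy_def)
qed (auto simp: behavioral_def table_strategy_def)

text \<open>The first player faces his decision only with a total of 5, so that Banker's view of him at that
  point is a third card or a stand, and Banker's drawing probability at \<open>(11, 10, 6)\<close> concerns
  only the second player. The second player's condition arises from this one by
  exchanging the last two probabilities, which forces them to be equal in equilibrium.\<close>
lemma vs_banker_slope_table:
  "vs_banker (9/11) (table_strategy r1 r2 r3) score_slope =
    16 / (169 * 24167 * 13 * 2197) * (6715965 - 11421696 * r1 - 10469888 * r2)"
proof -
  have counts: "draw_effect_count (slope_count 10) 6 = -143" "draw_effect_count (slope_count 11) 6 = 0"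
    by code_simp+
  have effects: "draw_effect (score_slope 10) 6 = - 176 / 2197" "draw_effect (score_slope 11) 6 = 0"
    using draw_effect_count[of "score_slope 10" "16 / 2197" "slope_count 10" 6, OF slope_count]
      draw_effect_count[of "score_slope 11" "16 / 2197" "slope_count 11" 6, OF slope_count]
    by (simp_all add: counts)
  have base: "table_strategy 0 0 0 (10, 10, 6) = 0" "table_strategy 0 0 0 (10, 11, 6) = 0"
      "table_strategy 0 0 0 (11, 10, 6) = 0"
    by (simp_all add: table_strategy_def)
  show ?thesis
    unfolding table_strategy_update[of r1 r2 r3]
    by (simp add: vs_banker_update vs_banker_count[OF slope_count] slope_count_total effects base
      seen_count seen_table_def pmf_two_count two_card_count_def field_simps)
qed

lemma vs_banker_mirrored_table:
  "vs_banker p (mirrored (table_strategy r1 r2 r3)) f = vs_banker p (table_strategy r1 r3 r2) f"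
  by (rule vs_banker_cong) (auto simp: mirrored_def table_strategy_def table_N_symmetric)

lemma draw_cost_count:
  assumes "k1 \<le> 11" "k2 \<le> 11" "j \<le> 7"
  shows "draw_cost \<theta> (9/11) (9/11) k1 k2 j =
    (\<theta> * of_int (seen_table ! k2 * swing_table ! k1 ! j) +
     (1 - \<theta>) * of_int (seen_table ! k1 * swing_table ! k2 ! j)) / (24167 * 314171)"
  using assms by (simp add: draw_cost_def seen_count swing_count add_divide_distrib)

lemma draw_cost_sign:
  assumes \<theta>: "799 / 1604 < \<theta>" "\<theta> \<le> 1 / 2" and k: "k1 \<le> 11" "k2 \<le> 11" "j \<le> 7"
  shows "if j \<le> table_N ! k1 ! k2 then draw_cost \<theta> (9/11) (9/11) k1 k2 j \<le> 0
         else draw_cost \<theta> (9/11) (9/11) k1 k2 j \<ge> 0"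
proof -
  define A B where "A = seen_table ! k2 * swing_table ! k1 ! j"
    and "B = seen_table ! k1 * swing_table ! k2 ! j"
  define l where "l = real_of_int (1 * A + 1 * B)"
  define r where "r = real_of_int (799 * A + 805 * B)"
  \<comment> \<open>up to factors, \<open>a\<close> and \<open>b\<close> are the distances of \<open>\<theta>\<close> from the endpoints of its range, so that
    the cost interpolates between \<open>l\<close> at \<open>1/2\<close> and \<open>r\<close> at \<open>799/1604\<close>\<close>
  define a b where "a = (1604 * \<theta> - 799) / 6" and "b = (1 - 2 * \<theta>) / 6"
  have cost: "draw_cost \<theta> (9/11) (9/11) k1 k2 j = (a * l + b * r) / (24167 * 314171)"
    unfolding draw_cost_count[OF k] A_def[symmetric] B_def[symmetric] l_def r_def a_def b_def
    by (simp add: field_simps)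
  have "a \<ge> 0" "b \<ge> 0"
    using \<theta> by (simp_all add: a_def b_def)
  have "if j \<le> table_N ! k1 ! k2 then l \<le> 0 \<and> r \<le> 0 else 0 \<le> l \<and> 0 \<le> r"
    using entries_optimal[of 1 1, OF _ k] entries_optimal[of 799 805, OF _ k]
    by (simp add: entry_optimal_def l_def r_def A_def B_def Let_def mult.assoc
        flip: of_int_add of_int_mult split: if_splits)
  then have "if j \<le> table_N ! k1 ! k2 then a * l + b * r \<le> 0 else 0 \<le> a * l + b * r"
    using \<open>a \<ge> 0\<close> \<open>b \<ge> 0\<close>
    by (simp add: add_nonpos_nonpos mult_nonneg_nonpos split: if_splits)
  then show ?thesis
    unfolding cost by (simp split: if_splits)
qed

text \<open>Each player who is still competing stands, and against a stand Banker's swing on 6 is zero;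
  a natural has no swing at all.\<close>
lemma draw_cost_zero:
  assumes "(k1, k2, j) \<in> {(10, 10, 6), (10, 11, 6), (11, 10, 6)}"
  shows "draw_cost \<theta> (9/11) (9/11) k1 k2 j = 0"
  using assms by (auto simp: draw_cost_def swing_count swing_table_def)

lemma draw_cost_naturals: "j \<le> 7 \<Longrightarrow> draw_cost \<theta> (9/11) (9/11) 11 11 j = 0"
proof -
  assume "j \<le> 7"
  then have "swing_table ! 11 ! j = 0"
    by (auto simp: swing_table_def nth_Cons')
  then show ?thesis
    using \<open>j \<le> 7\<close> by (simp add: draw_cost_def swing_count)
qed

lemma table_strategy_best_response:
  assumes \<theta>: "799 / 1604 < \<theta>" "\<theta> \<le> 1 / 2"
    and r: "r1 \<in> {0..1}" "r2 \<in> {0..1}" "r3 \<in> {0..1}" and "behavioral \<beta>"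
  shows "banker_payoff \<theta> (9/11) (9/11) \<beta> \<le> banker_payoff \<theta> (9/11) (9/11) (table_strategy r1 r2 r3)"
proof -
  let ?t = "table_strategy r1 r2 r3"
  have "0 \<le> (\<beta> (k1, k2, y) - ?t (k1, k2, y)) * draw_cost \<theta> (9/11) (9/11) k1 k2 y"
    if k: "k1 \<le> 11" "k2 \<le> 11" "y \<le> 7" for k1 k2 y
  proof (cases "(k1, k2, y) \<in> {(10, 10, 6), (10, 11, 6), (11, 10, 6)} \<or> k1 = 11 \<and> k2 = 11")
    case True
    then show ?thesis
      using draw_cost_zero[of k1 k2 y \<theta>] draw_cost_naturals[of y \<theta>] k by auto
  next
    case False
    then have "\<beta> (k1, k2, y) \<in> {0..1}"
      using \<open>behavioral \<beta>\<close> k by (auto simp: behavioral_def info_sets_def)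
    moreover have "?t (k1, k2, y) = (if y \<le> table_N ! k1 ! k2 then 1 else 0)"
      using False by (auto simp: table_strategy_def)
    ultimately show ?thesis
      using draw_cost_sign[OF \<theta> k] by (auto intro: mult_nonpos_nonpos split: if_splits)
  qed
  then have "0 \<le> banker_payoff \<theta> (9/11) (9/11) ?t - banker_payoff \<theta> (9/11) (9/11) \<beta>"
    using r \<open>behavioral \<beta>\<close>
    by (subst banker_payoff_diff)
      (auto simp: behavioral_table_strategy
        intro!: sum_nonneg mult_nonneg_nonneg[OF pmf_nonneg])
  then show ?thesis by simp
qed

lemma banker_payoff_indifferent:
  assumes "behavioral \<beta>" "behavioral \<beta>'"
    and "\<And>s. s \<notin> {(10, 10, 6), (10, 11, 6), (11, 10, 6)} \<Longrightarrow> \<beta> s = \<beta>' s"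
  shows "banker_payoff \<theta> (9/11) (9/11) \<beta> = banker_payoff \<theta> (9/11) (9/11) \<beta>'"
proof -
  have "(\<beta>' (k1, k2, y) - \<beta> (k1, k2, y)) * draw_cost \<theta> (9/11) (9/11) k1 k2 y = 0" for k1 k2 y
    using draw_cost_zero[of k1 k2 y \<theta>] assms(3)[of "(k1, k2, y)"]
    by (cases "(k1, k2, y) \<in> {(10, 10, 6), (10, 11, 6), (11, 10, 6)}") simp_all
  then have "banker_payoff \<theta> (9/11) (9/11) \<beta> - banker_payoff \<theta> (9/11) (9/11) \<beta>' = 0"
    by (subst banker_payoff_diff[OF assms(1,2)]) (simp only: mult_zero_right sum.neutral_const)
  then show ?thesis by simp
qed

lemma nash_table_strategy_iff:
  assumes \<theta>: "799 / 1604 < \<theta>" "\<theta> \<le> 1 / 2"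
  shows "nash_equilibrium \<theta> (9/11) (9/11) (table_strategy r1 r2 r3) \<longleftrightarrow>
    r1 \<in> {0..1} \<and> r2 \<in> {0..1} \<and> r3 = r2 \<and> 11421696 * r1 + 10469888 * r2 = 6715965"
    (is "?nash \<longleftrightarrow> ?line")
proof (cases "behavioral (table_strategy r1 r2 r3)")
  case True
  then have r: "r1 \<in> {0..1}" "r2 \<in> {0..1}" "r3 \<in> {0..1}"
    by (simp_all add: behavioral_table_strategy)
  have "?nash \<longleftrightarrow> vs_banker (9/11) (table_strategy r1 r2 r3) score_slope = 0 \<and>
      vs_banker (9/11) (table_strategy r1 r3 r2) score_slope = 0"
    unfolding nash_equilibrium_def
    using True table_strategy_best_response[OF \<theta> r] \<theta>
    by (simp add: player_optimal_iff vs_banker_mirrored_table)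
  also have "\<dots> \<longleftrightarrow> ?line"
    using r unfolding vs_banker_slope_table by auto
  finally show ?thesis .
next
  case False
  then show ?thesis
    by (auto simp: nash_equilibrium_def behavioral_table_strategy)
qed

lemma indifference_line_eq_segment:
  "{(r1, r2, r3). r1 \<in> {0..1} \<and> r2 \<in> {0..1} \<and> r3 = r2 \<and> 11421696 * r1 + 10469888 * r2 = 6715965} =
    closed_segment (0, 6715965 / 10469888, 6715965 / 10469888) (2238655 / 3807232, 0, 0 :: real)"
  (is "?L = ?R")
proof (intro set_eqI)
  fix r :: "real \<times> real \<times> real"
  obtain r1 r2 r3 where r: "r = (r1, r2, r3)" by (cases r)
  have "r \<in> ?R \<longleftrightarrow> (\<exists>u. 0 \<le> u \<and> u \<le> 1 \<and> r1 = u * (2238655 / 3807232) \<and>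
      r2 = (1 - u) * (6715965 / 10469888) \<and> r3 = r2)"
    by (auto simp: r in_segment)
  also have "\<dots> \<longleftrightarrow> r \<in> ?L"
  proof
    assume "r \<in> ?L"
    then show "\<exists>u. 0 \<le> u \<and> u \<le> 1 \<and> r1 = u * (2238655 / 3807232) \<and>
      r2 = (1 - u) * (6715965 / 10469888) \<and> r3 = r2"
      by (intro exI[of _ "r1 * (3807232 / 2238655)"]) (auto simp: r field_simps)
  qed (auto simp: r field_simps)
  finally show "r \<in> ?L \<longleftrightarrow> r \<in> ?R" by simp
qed

text \<open>By indifference the value can be computed at any choice of the three probabilities. With all of
  them 0 Banker's strategy is symmetric, and for equal stakes his gain per unit is what
  either player loses per unit of his own stake.\<close>
lemma banker_value:
  assumes "r1 \<in> {0..1}" "r2 \<in> {0..1}" "r3 \<in> {0..1}"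
  shows "banker_payoff (1/2) (9/11) (9/11) (table_strategy r1 r2 r3) = 11138203216 / (11\<^sup>2 * 13 ^ 9)"
proof -
  have "banker_payoff (1/2) (9/11) (9/11) (table_strategy r1 r2 r3) =
     banker_payoff (1/2) (9/11) (9/11) (table_strategy 0 0 0)"
    using assms
    by (intro banker_payoff_indifferent)
      (simp_all add: behavioral_table_strategy, simp add: table_strategy_update[of r1 r2 r3])
  also have "\<dots> = - (banker_natural_gain + vs_banker (9/11) (table_strategy 0 0 0) (score (9/11)))"
    by (simp add: banker_payoff_zero_sum payoff1_eq payoff2_eq behavioral_table_strategy vs_banker_mirrored_table)
  also have "banker_natural_gain = - 4384 / 28561"
  proof -
    have nums: "{..9::nat} = {0,1,2,3,4,5,6,7,8,9}" "{8..9::nat} = {8,9}" by auto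
    show ?thesis
      by (simp add: banker_natural_gain_def nums pmf_two_count two_card_count_def)
  qed
  finally show ?thesis
    by (simp add: vs_banker_count[OF score_count] score_count_total)
qed

theorem mainTheorem11:
  "(\<forall>\<theta>::real. 799 / 1604 < \<theta> \<and> \<theta> \<le> 1 / 2 \<longrightarrow>
      {(r1, r2, r3). nash_equilibrium \<theta> (9/11) (9/11) (table_strategy r1 r2 r3)} =
        closed_segment (0, 6715965 / 10469888, 6715965 / 10469888) (2238655 / 3807232, 0, 0) \<and>
      (\<forall>r1\<in>{0..1}. \<forall>r2\<in>{0..1}. \<forall>r3\<in>{0..1}.
         \<forall>s\<in>{(10, 10, 6), (10, 11, 6), (11, 10, 6)}. \<forall>a\<in>{0..1}.
           banker_payoff \<theta> (9/11) (9/11) ((table_strategy r1 r2 r3)(s := a)) =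
           banker_payoff \<theta> (9/11) (9/11) (table_strategy r1 r2 r3))) \<and>
   (\<forall>r1 r2 r3. nash_equilibrium (1/2) (9/11) (9/11) (table_strategy r1 r2 r3) \<longrightarrow>
      banker_payoff (1/2) (9/11) (9/11) (table_strategy r1 r2 r3) =
        11138203216 / (11\<^sup>2 * 13 ^ 9)) \<and>
   \<bar>11138203216 / (11\<^sup>2 * 13 ^ 9) - (0.00868040 :: real)\<bar> < 5 / 10 ^ 9"
proof (intro conjI allI impI ballI; (elim conjE)?)
  fix \<theta> :: real assume "799 / 1604 < \<theta>" "\<theta> \<le> 1 / 2"
  then show "{(r1, r2, r3). nash_equilibrium \<theta> (9/11) (9/11) (table_strategy r1 r2 r3)} =
      closed_segment (0, 6715965 / 10469888, 6715965 / 10469888) (2238655 / 3807232, 0, 0)"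
    by (simp only: nash_table_strategy_iff indifference_line_eq_segment)
next
  fix \<theta> r1 r2 r3 a :: real and s :: "nat \<times> nat \<times> nat"
  assume "r1 \<in> {0..1}" "r2 \<in> {0..1}" "r3 \<in> {0..1}" and a: "a \<in> {0..1}"
    and s: "s \<in> {(10, 10, 6), (10, 11, 6), (11, 10, 6)}"
  then have "behavioral (table_strategy r1 r2 r3)"
    by (simp add: behavioral_table_strategy)
  then show "banker_payoff \<theta> (9/11) (9/11) ((table_strategy r1 r2 r3)(s := a)) =
      banker_payoff \<theta> (9/11) (9/11) (table_strategy r1 r2 r3)"
    using a s by (intro banker_payoff_indifferent) (auto simp: behavioral_def)
next
  fix r1 r2 r3 :: real
  assume "nash_equilibrium (1/2) (9/11) (9/11) (table_strategy r1 r2 r3)"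
  then show "banker_payoff (1/2) (9/11) (9/11) (table_strategy r1 r2 r3) = 11138203216 / (11\<^sup>2 * 13 ^ 9)"
    by (intro banker_value) (simp_all add: nash_equilibrium_def behavioral_table_strategy)
qed simp

end
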